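(* Let $(\Omega,\mu)$ be a complete measure space with $\mu(\Omega)\in(0,+\infty)$. Fix $p\ge1$ and $q,r\ge0$. Then for any $f\in L^p(\log L)^q(\log\log L)^r(\Omega,\mu)$, $$\int_\Omega|f|\,d\mu\le\frac{2C\,\|f\|_{L^p(\log L)^q(\log\log L)^r(\Omega,\mu)}\,\bigl(\mu(\Omega)\bigr)^{1-\frac1p}}{\log^{\frac qp}\left(1+\frac1{\mu(\Omega)}\right)\log^{\frac rp}\left(1+\log\left(1+\frac1{\mu(\Omega)}\right)\right)},$$ where $C:=\left(p+\frac q2+\frac r4\right)^{\frac{q+r}{p}}$.
   Context: $\log^a x$ means $(\log x)^a$. For $p\ge1$, $q,r\ge0$ put $\Phi_{p,q,r}(t)=t^p\log^q(1+t)\log^r(1+\log(1+t))$, $t\ge0$. The space $L^p(\log L)^q(\log\log L)^r(\Omega,\mu)$ is the Orlicz space of all measurable functions $f$ on $(\Omega,\mu)$ for which there is $c>0$ with $\int_\Omega\Phi_{p,q,r}(|f|/c)\,d\mu\le1$, with the Luxemburg norm $$\|f\|_{L^p(\log L)^q(\log\log L)^r(\Omega,\mu)}=\inf\Bigl\{c>0:\int_\Omega\Phi_{p,q,r}\Bigl(\frac{|f|}{c}\Bigr)d\mu\le1\Bigr\}.$$ *)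

theory Defs
  imports "HOL-Analysis.Analysis"
begin

definition orlicz_space :: "(real \<Rightarrow> real) \<Rightarrow> 'a measure \<Rightarrow> ('a \<Rightarrow> real) set" where
  "orlicz_space \<Phi> M =
     {f \<in> borel_measurable M. \<exists>c>0. (\<integral>\<^sup>+x. ennreal (\<Phi> (\<bar>f x\<bar> / c)) \<partial>M) \<le> 1}"

(* For f in the space, the real infimum is over a nonempty set bounded below by 0; outside
   the space the value carries no meaning. *)
definition luxemburg_norm :: "(real \<Rightarrow> real) \<Rightarrow> 'a measure \<Rightarrow> ('a \<Rightarrow> real) \<Rightarrow> real" where
  "luxemburg_norm \<Phi> M f =
     Inf {c. c > 0 \<and> (\<integral>\<^sup>+x. ennreal (\<Phi> (\<bar>f x\<bar> / c)) \<partial>M) \<le> 1}"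

(* For t > 0 all bases are positive, so powr is the usual real power (in particular
   x powr 0 = 1).  At t = 0 the value is 0 because 0 powr p = 0, independently of the
   library convention 0 powr 0 = 0 for the logarithmic factors. *)
definition Phi :: "real \<Rightarrow> real \<Rightarrow> real \<Rightarrow> real \<Rightarrow> real" where
  "Phi p q r t = t powr p * ln (1 + t) powr q * ln (1 + ln (1 + t)) powr r"

definition Zygmund_space :: "real \<Rightarrow> real \<Rightarrow> real \<Rightarrow> 'a measure \<Rightarrow> ('a \<Rightarrow> real) set" where
  "Zygmund_space p q r M = orlicz_space (Phi p q r) M"

definition Zygmund_norm :: "real \<Rightarrow> real \<Rightarrow> real \<Rightarrow> 'a measure \<Rightarrow> ('a \<Rightarrow> real) \<Rightarrow> real" where
  "Zygmund_norm p q r M f = luxemburg_norm (Phi p q r) M f"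

end

(* If the integral of Phi(g) is at most 1 and T > 0 satisfies Phi(T) >= 1/m, then, since
   Phi(t)/t is nondecreasing, g <= T + m T Phi(g) pointwise (split at g = T), and integration
   gives 2 T m.  The asserted bound is this one with
   T = C (s / (ln(1+s)^q ln(1+ln(1+s))^r))^(1/p), s = 1/m.
   To see Phi(T) >= s, put K = p + q/2 + r/4 and 1 + s = (1+u)^K.  As ln(1+u) <= u^(1/2) and
   ln(1+ln(1+u)) <= u^(1/4), we have Phi(u) <= u^K <= s.  Also ln(1+s) = K ln(1+u) and, by
   Bernoulli, ln(1+ln(1+s)) <= K ln(1+ln(1+u)); hence T >= u, and the same two comparisons
   with T in place of u yield Phi(T) >= s. *)
theory Submission
  imports Defs
begin

text \<open>With y = sqrt u the difference of the sides is y - ln (1 + y^2), which vanishes at 0 and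
  has derivative (1 - y)^2 / (1 + y^2).\<close>

lemma ln_one_plus_le_sqrt:
  fixes u :: real
  assumes "u \<ge> 0"
  shows "ln (1 + u) \<le> sqrt u"
proof -
  define g where "g = (\<lambda>y::real. y - ln (1 + y\<^sup>2))"
  have "g 0 \<le> g (sqrt u)"
  proof (rule DERIV_nonneg_imp_nondecreasing[where f = g])
    fix y :: real
    have pos: "1 + y\<^sup>2 > 0"
      by (simp add: add_pos_nonneg)
    have "(g has_real_derivative (1 - 2 * y / (1 + y\<^sup>2))) (at y)"
      unfolding g_def using pos by (auto intro!: derivative_eq_intros)
    moreover have "1 - 2 * y / (1 + y\<^sup>2) \<ge> 0"
      using pos zero_le_power2[of "y - 1"] by (simp add: power2_diff)
    ultimately show "\<exists>d. (g has_real_derivative d) (at y) \<and> 0 \<le> d" by blast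
  qed (use assms in simp)
  then show ?thesis using assms by (simp add: g_def)
qed

text \<open>Bernoulli's inequality 1 + K x <= (1 + x)^K in logarithmic form. It serves to pull the
  factor \<open>K\<close> out of the iterated logarithm.\<close>

lemma ln_one_plus_mult_le:
  fixes K x :: real
  assumes "K \<ge> 1" "x \<ge> 0"
  shows "ln (1 + K * x) \<le> K * ln (1 + x)"
proof -
  define g where "g = (\<lambda>y::real. K * ln (1 + y) - ln (1 + K * y))"
  have "g 0 \<le> g x"
  proof (rule DERIV_nonneg_imp_nondecreasing[where f = g])
    fix y :: real assume y: "0 \<le> y"
    then have pos: "1 + y > 0" "1 + K * y > 0" and le: "1 + y \<le> 1 + K * y"
      using assms mult_right_mono[of 1 K y] by (auto simp: add_pos_nonneg)
    have "(g has_real_derivative (K / (1 + y) - K / (1 + K * y))) (at y)"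
      unfolding g_def using pos by (auto intro!: derivative_eq_intros)
    moreover have "K / (1 + y) - K / (1 + K * y) \<ge> 0"
      using pos le assms by (simp add: divide_left_mono)
    ultimately show "\<exists>d. (g has_real_derivative d) (at y) \<and> 0 \<le> d" by blast
  qed (use assms in simp)
  then show ?thesis by (simp add: g_def)
qed

text \<open>Split one factor off each power: the cofactors 1 and u^(K-1) are both at most (1 +
  u)^(K-1), because K - 1 >= 0.\<close>

lemma one_plus_powr_le:
  fixes K u :: real
  assumes "K \<ge> 1" "u > 0"
  shows "1 + u powr K \<le> (1 + u) powr K"
proof -
  have split: "a powr K = a powr (K - 1) * a" if "a > 0" for a :: real
    using that powr_add[of a "K - 1" 1] by simp
  have "1 \<le> (1 + u) powr (K - 1)" "u powr (K - 1) \<le> (1 + u) powr (K - 1)"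
    using assms by (auto intro: ge_one_powr_ge_zero powr_mono2)
  then have "1 + u powr (K - 1) * u \<le> (1 + u) powr (K - 1) + (1 + u) powr (K - 1) * u"
    using assms by (intro add_mono mult_right_mono) auto
  also have "\<dots> = (1 + u) powr K"
    using assms split[of "1 + u"] by (simp add: algebra_simps)
  finally show ?thesis
    using assms split[of u] by simp
qed

lemma Phi_nonneg: "Phi p q r t \<ge> 0"
  by (simp add: Phi_def)

text \<open>The square-root bound used once gives the 1/2 beside \<open>q\<close>; used twice, on
  the iterated logarithm, it gives the 1/4 beside \<open>r\<close>. This exponent is the base of the
  power that defines the constant C.\<close>

lemma Phi_le_powr:
  assumes "q \<ge> 0" "r \<ge> 0" "u > 0"
  shows "Phi p q r u \<le> u powr (p + q / 2 + r / 4)"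
proof -
  have L: "ln (1 + u) \<ge> 0" using assms by simp
  have "ln (1 + ln (1 + u)) \<le> sqrt (ln (1 + u))"
    using L by (rule ln_one_plus_le_sqrt)
  also have "\<dots> \<le> sqrt (sqrt u)"
    using assms by (simp add: ln_one_plus_le_sqrt)
  also have "\<dots> = u powr (1 / 4)"
    using assms by (simp add: powr_half_sqrt[symmetric] powr_powr)
  finally have "ln (1 + ln (1 + u)) powr r \<le> (u powr (1 / 4)) powr r"
    using assms L by (intro powr_mono2) auto
  moreover have "ln (1 + u) powr q \<le> (u powr (1 / 2)) powr q"
    using assms ln_one_plus_le_sqrt[of u] by (intro powr_mono2) (auto simp: powr_half_sqrt)
  ultimately have "Phi p q r u \<le> u powr p * (u powr (1 / 2)) powr q * (u powr (1 / 4)) powr r"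
    unfolding Phi_def by (intro mult_mono) auto
  then show ?thesis by (simp add: powr_powr powr_add)
qed

text \<open>Phi(t)/t is the product of t^(p-1) and two powers of logarithms, each nondecreasing
  because the exponents p - 1, q, r are nonnegative.\<close>

lemma Phi_mult_right_le:
  assumes "p \<ge> 1" "q \<ge> 0" "r \<ge> 0" "0 < T" "T \<le> t"
  shows "t * Phi p q r T \<le> T * Phi p q r t"
proof -
  have split: "a powr p = a * a powr (p - 1)" if "a > 0" for a :: real
    using that powr_add[of a 1 "p - 1"] by simp
  have l: "ln (1 + T) \<le> ln (1 + t)" "0 \<le> ln (1 + T)" using assms by auto
  then have ll: "ln (1 + ln (1 + T)) \<le> ln (1 + ln (1 + t))" "0 \<le> ln (1 + ln (1 + T))" by auto
  have "T powr (p - 1) * ln (1 + T) powr q * ln (1 + ln (1 + T)) powr r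
      \<le> t powr (p - 1) * ln (1 + t) powr q * ln (1 + ln (1 + t)) powr r"
    using assms l ll by (intro mult_mono powr_mono2) auto
  \<comment> \<open>The common factor supplies the missing T on the left and the missing t on the
    right, completing the exponent p - 1 to p.\<close>
  then have "(t * T) * (T powr (p - 1) * ln (1 + T) powr q * ln (1 + ln (1 + T)) powr r)
      \<le> (t * T) * (t powr (p - 1) * ln (1 + t) powr q * ln (1 + ln (1 + t)) powr r)"
    using assms by (intro mult_left_mono) auto
  then show ?thesis
    using assms split[of T] split[of t] by (simp add: Phi_def mult_ac)
qed

text \<open>\<open>T\<close> is chosen to solve T^p L^q LL^r = K^(q+r) s, where L and LL are the
  logarithms at s. It therefore suffices that L and LL are at most K times the corresponding
  logarithms at T, which holds once T >= u.\<close>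

lemma le_Phi_explicit:
  fixes p q r s :: real
  assumes p: "p \<ge> 1" and q: "q \<ge> 0" and r: "r \<ge> 0" and s: "s > 0"
  defines "T \<equiv> (p + q / 2 + r / 4) powr ((q + r) / p) * s powr (1 / p) /
      (ln (1 + s) powr (q / p) * ln (1 + ln (1 + s)) powr (r / p))"
  shows "s \<le> Phi p q r T"
proof -
  define K where "K = p + q / 2 + r / 4"
  define L where "L = ln (1 + s)"
  define LL where "LL = ln (1 + L)"
  define u where "u = (1 + s) powr (1 / K) - 1"
  have K: "K \<ge> 1" using p q r by (simp add: K_def)
  have L: "L > 0" using s by (simp add: L_def)
  have LL: "LL > 0" using L by (simp add: LL_def)
  have u: "u > 0" using s K by (simp add: u_def)
  have us: "(1 + u) powr K = 1 + s" using s K by (simp add: u_def powr_powr)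
  have Lu: "L = K * ln (1 + u)" using u us unfolding L_def by (metis ln_powr)
  have LL_le: "LL \<le> K * ln (1 + ln (1 + v))" if "u \<le> v" for v
  proof -
    have "LL \<le> K * ln (1 + ln (1 + u))"
      unfolding LL_def Lu using K u by (intro ln_one_plus_mult_le) auto
    also have "\<dots> \<le> K * ln (1 + ln (1 + v))"
      using K u that by (intro mult_left_mono) (auto simp: add_pos_nonneg)
    finally show ?thesis .
  qed
  have L_le: "L \<le> K * ln (1 + v)" if "u \<le> v" for v
    unfolding Lu using K u that by (intro mult_left_mono) auto
  \<comment> \<open>Needed for two values: at \<open>v = u\<close> to show \<open>u \<le> T\<close>,
    then at \<open>v = T\<close> for the conclusion.\<close>
  have logs: "L powr q * LL powr r \<le>
      K powr (q + r) * (ln (1 + v) powr q * ln (1 + ln (1 + v)) powr r)" if "u \<le> v" for v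
  proof -
    have "L powr q * LL powr r \<le> (K * ln (1 + v)) powr q * (K * ln (1 + ln (1 + v))) powr r"
      using L LL L_le[OF that] LL_le[OF that] q r by (intro mult_mono powr_mono2) auto
    also have "\<dots> = K powr (q + r) * (ln (1 + v) powr q * ln (1 + ln (1 + v)) powr r)"
      using K u that by (simp add: powr_mult powr_add)
    finally show ?thesis .
  qed
  have T: "T > 0" unfolding T_def using L LL s K by (simp add: K_def L_def LL_def)
  have Tp: "T powr p = K powr (q + r) * s / (L powr q * LL powr r)"
    unfolding T_def K_def[symmetric] L_def[symmetric] LL_def[symmetric]
    using L LL s K p by (simp add: powr_mult powr_divide powr_powr)
  have D: "L powr q * LL powr r > 0" using L LL by simp
  \<comment> \<open>If T < u, the formula for T^p would give s < Phi(u), whereas Phi(u) <= u^K <= (1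
    + u)^K - 1 = s.\<close>
  have "u \<le> T"
  proof (rule ccontr)
    assume "\<not> u \<le> T"
    then have "T powr p < u powr p" using T p by (intro powr_less_mono2) auto
    then have "K powr (q + r) * s < u powr p * (L powr q * LL powr r)"
      unfolding Tp using D by (simp add: pos_divide_less_eq)
    also have "\<dots> \<le> u powr p *
        (K powr (q + r) * (ln (1 + u) powr q * ln (1 + ln (1 + u)) powr r))"
      using logs[of u] by (intro mult_left_mono) auto
    also have "\<dots> = K powr (q + r) * Phi p q r u"
      by (simp add: Phi_def)
    finally have "s < Phi p q r u" using K by simp
    also have "\<dots> \<le> u powr K" unfolding K_def using q r u by (rule Phi_le_powr)
    also have "\<dots> \<le> s" using one_plus_powr_le[OF K u] us by simp
    finally show False by simp
  qed
  from logs[OF this] have "s * (L powr q * LL powr r) \<le>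
      s * (K powr (q + r) * (ln (1 + T) powr q * ln (1 + ln (1 + T)) powr r))"
    using s by (intro mult_left_mono) auto
  then have "s \<le> K powr (q + r) * s / (L powr q * LL powr r) *
      (ln (1 + T) powr q * ln (1 + ln (1 + T)) powr r)"
    using D by (simp add: pos_le_divide_eq mult_ac)
  then show ?thesis
    unfolding Phi_def Tp by (simp add: mult_ac)
qed

text \<open>Both summands of the pointwise bound contribute at most T m: the constant T because the
  total mass is m, the other because Phi(g) has integral at most 1. This is the origin of the factor
  2.\<close>

lemma nn_integral_le_of_Phi_le_1:
  fixes M :: "'a measure" and g :: "'a \<Rightarrow> real"
  assumes p: "p \<ge> 1" and q: "q \<ge> 0" and r: "r \<ge> 0"
    and m: "emeasure M (space M) = ennreal m" "m > 0"
    and T: "T > 0" "1 / m \<le> Phi p q r T"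
    and [measurable]: "g \<in> borel_measurable M"
    and int: "(\<integral>\<^sup>+x. ennreal (Phi p q r (g x)) \<partial>M) \<le> 1"
  shows "(\<integral>\<^sup>+x. ennreal (g x) \<partial>M) \<le> ennreal (2 * T * m)"
proof -
  have pt: "g x \<le> T + m * T * Phi p q r (g x)" for x
  proof (cases "g x \<le> T")
    case True
    then show ?thesis using m T Phi_nonneg[of p q r "g x"] by (simp add: add_increasing2)
  next
    case False
    then have "g x * (1 / m) \<le> g x * Phi p q r T"
      using T by (intro mult_left_mono) auto
    also have "\<dots> \<le> T * Phi p q r (g x)"
      using False p q r T by (intro Phi_mult_right_le) auto
    finally have "g x \<le> m * T * Phi p q r (g x)"
      using m by (simp add: field_simps)
    then show ?thesis using T by simp
  qed
  have "(\<integral>\<^sup>+x. ennreal (g x) \<partial>M)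
      \<le> (\<integral>\<^sup>+x. ennreal T + ennreal (m * T) * ennreal (Phi p q r (g x)) \<partial>M)"
  proof (rule nn_integral_mono)
    fix x
    have "ennreal (g x) \<le> ennreal (T + m * T * Phi p q r (g x))"
      using pt by (rule ennreal_leI)
    also have "\<dots> = ennreal T + ennreal (m * T) * ennreal (Phi p q r (g x))"
      using m T Phi_nonneg[of p q r "g x"] by (simp add: ennreal_mult ennreal_plus)
    finally show "ennreal (g x) \<le> ennreal T + ennreal (m * T) * ennreal (Phi p q r (g x))" .
  qed
  also have "\<dots> = ennreal T * ennreal m
      + ennreal (m * T) * (\<integral>\<^sup>+x. ennreal (Phi p q r (g x)) \<partial>M)"
    unfolding Phi_def by (subst nn_integral_add) (auto simp: nn_integral_cmult m)
  also have "\<dots> \<le> ennreal T * ennreal m + ennreal (m * T) * 1"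
    using int by (intro add_left_mono mult_left_mono) auto
  also have "\<dots> = ennreal (2 * T * m)"
    using m T by (simp add: ennreal_mult[symmetric] ennreal_plus[symmetric] del: ennreal_plus)
  finally show ?thesis .
qed

theorem theorem2p9:
  fixes M :: "'a measure" and f :: "'a \<Rightarrow> real" and p q r :: real
  assumes "complete_measure M"
    and "0 < emeasure M (space M)" and "emeasure M (space M) < \<infinity>"
    and "p \<ge> 1" and "q \<ge> 0" and "r \<ge> 0"
    and "f \<in> Zygmund_space p q r M"
  defines "m \<equiv> measure M (space M)"
    and "C \<equiv> (p + q / 2 + r / 4) powr ((q + r) / p)"
  shows "(\<integral>\<^sup>+x. ennreal \<bar>f x\<bar> \<partial>M) \<le>
    ennreal (2 * C * Zygmund_norm p q r M f * m powr (1 - 1 / p) /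
      (ln (1 + 1 / m) powr (q / p) * ln (1 + ln (1 + 1 / m)) powr (r / p)))"
proof -
  define S where "S = {c. c > 0 \<and> (\<integral>\<^sup>+x. ennreal (Phi p q r (\<bar>f x\<bar> / c)) \<partial>M) \<le> 1}"
  define D where "D = ln (1 + 1 / m) powr (q / p) * ln (1 + ln (1 + 1 / m)) powr (r / p)"
  define T where "T = C * (1 / m) powr (1 / p) / D"
  have em: "emeasure M (space M) = ennreal m"
    unfolding m_def using assms(3) by (intro emeasure_eq_ennreal_measure) auto
  then have m: "m > 0" using assms(2) by (simp add: ennreal_zero_less_mult_iff)
  have "0 < ln (1 + 1 / m)" using m by (intro ln_gt_zero) simp
  then have D: "D > 0" unfolding D_def by simp
  have C: "C > 0" using assms(4-6) unfolding C_def by simp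
  have T: "T > 0" using m C D unfolding T_def by simp
  have sT: "1 / m \<le> Phi p q r T"
    unfolding T_def D_def C_def using assms(4-6) m by (intro le_Phi_explicit) auto
  have f[measurable]: "f \<in> borel_measurable M" and S: "S \<noteq> {}"
    using assms(7) by (auto simp: Zygmund_space_def orlicz_space_def S_def)
  define I where "I = (\<integral>\<^sup>+x. ennreal \<bar>f x\<bar> \<partial>M)"
  \<comment> \<open>Every admissible c can stand in for the norm: the bound for |f|/c is scaled back
    by c.\<close>
  have I_le: "I \<le> ennreal (c * (2 * T * m))" if "c \<in> S" for c
  proof -
    have c: "c > 0" and int: "(\<integral>\<^sup>+x. ennreal (Phi p q r (\<bar>f x\<bar> / c)) \<partial>M) \<le> 1"
      using that by (auto simp: S_def)
    have "I = (\<integral>\<^sup>+x. ennreal c * ennreal (\<bar>f x\<bar> / c) \<partial>M)"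
      unfolding I_def using c by (intro nn_integral_cong) (simp add: ennreal_mult[symmetric])
    also have "\<dots> = ennreal c * (\<integral>\<^sup>+x. ennreal (\<bar>f x\<bar> / c) \<partial>M)"
      by (rule nn_integral_cmult) measurable
    also have "\<dots> \<le> ennreal c * ennreal (2 * T * m)"
      using assms(4-6) em m T sT int
      by (intro mult_left_mono nn_integral_le_of_Phi_le_1) auto
    also have "\<dots> = ennreal (c * (2 * T * m))"
      using c m T by (simp add: ennreal_mult)
    finally show ?thesis .
  qed
  \<comment> \<open>A single admissible c makes the integral finite, so the infimum can be taken
    among real numbers.\<close>
  have "I < \<infinity>"
    using S I_le by (metis all_not_in_conv ennreal_less_top infinity_ennreal_def le_less_trans)
  then obtain i where i: "I = ennreal i" "i \<ge> 0"
    by (cases I) auto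
  \<comment> \<open>\<open>T\<close> does not depend on c, so this quotient is a lower bound of
    \<open>S\<close>, whose infimum is the norm.\<close>
  have "i / (2 * T * m) \<le> Inf S"
  proof (rule cInf_greatest[OF S])
    fix c assume c: "c \<in> S"
    then have "c > 0" by (simp add: S_def)
    then have "i \<le> c * (2 * T * m)"
      using I_le[OF c] i m T by simp
    then show "i / (2 * T * m) \<le> c" using m T by (simp add: pos_divide_le_eq)
  qed
  then have "i \<le> 2 * Zygmund_norm p q r M f * (T * m)"
    using m T by (simp add: pos_divide_le_eq Zygmund_norm_def luxemburg_norm_def S_def mult_ac)
  \<comment> \<open>The power of the total mass arises from (1/m)^(1/p) m = m^(1-1/p).\<close>
  also have "T * m = C * m powr (1 - 1 / p) / D"
    unfolding T_def using m by (simp add: powr_diff powr_divide)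
  finally have "i \<le> 2 * C * Zygmund_norm p q r M f * m powr (1 - 1 / p) / D"
    by (simp add: mult_ac)
  then show ?thesis
    using i unfolding I_def D_def by (simp add: ennreal_leI)
qed

end
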